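(* Let $\mathcal{H}$, $A$, $C$, $\mu$, $S$, $(\gamma_n)_{n\in\mathbb{N}}$, $(M_n)_{n\in\mathbb{N}}$, $(\zeta_n)_{n\in\mathbb{N}}$ be as in the context, and let $\boldsymbol{Z}=\operatorname{zer}(A+C)\neq\varnothing$. Let $(\alpha_n)_{n\in\mathbb{N}}$, $(\beta_n)_{n\in\mathbb{N}}$, $(\theta_n)_{n\in\mathbb{N}}$ be sequences in $[0,1]$, let $(x_0,x_{-1},u_0)\in\mathcal{H}^3$, and let $(x_n)_{n\in\mathbb{N}}$ be defined recursively by $$(\forall n\in\mathbb{N})\quad \begin{cases} y_n=x_n+\alpha_n(x_n-x_{n-1}),\\ z_n=x_n+\beta_n(x_n-x_{n-1}),\\ x_{n+1}=(M_n+A)^{-1}\left(M_ny_n-Cz_n+u_n/\gamma_n+\theta_nS(x_n-x_{n-1})/\gamma_n\right),\\ u_{n+1}=(\gamma_nM_n-S)x_{n+1}-(\gamma_nM_n-S)y_n.\end{cases}$$ For every $n\ge1$ define $$\tilde\alpha_n=\alpha_n+\theta_n,\qquad \eta_n=1-\tilde\alpha_n-\frac{\gamma_n(1-\beta_n)}{2\mu}-\zeta_n(1-\alpha_n)-\zeta_{n-1},$$ $$\xi_n=2\tilde\alpha_n-\frac{\gamma_n\beta_n(1-\beta_n)}{2\mu}-\zeta_n\alpha_n(1-\alpha_n).$$ Suppose that there exist an integer $N_0\ge1$ and $\epsilon\in\,]0,+\infty[$ such that $(\tilde\alpha_n)_{n\ge N_0}$ is non-decreasing and $$(\forall n\ge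 N_0)\quad \tilde\alpha_n-\frac{\gamma_n\beta_n}{2\mu}-\zeta_n\alpha_n\ge0\quad\text{and}\quad \eta_n-\xi_{n+1}\ge\epsilon.$$ Then $(x_n)_{n\in\mathbb{N}}$ converges weakly to a point in $\boldsymbol{Z}$.
   Context: $\mathbb{N}=\{0,1,2,\dots\}$. $\mathcal{H}$ is a real Hilbert space with inner product $\langle\cdot\mid\cdot\rangle$ and norm $\|\cdot\|$. $S\colon\mathcal{H}\to\mathcal{H}$ is a bounded linear self-adjoint strongly monotone operator (i.e. there is $a>0$ with $\langle Sx\mid x\rangle\ge a\|x\|^2$ for all $x$); $\|x\|_S=\sqrt{\langle Sx\mid x\rangle}$ and $\|x\|_{S^{-1}}=\sqrt{\langle S^{-1}x\mid x\rangle}$. An operator $T\colon\mathcal{H}\to\mathcal{H}$ is $\beta$-cocoercive with respect to $S$ ($\beta>0$) if $\langle x-y\mid Tx-Ty\rangle\ge\beta\|Tx-Ty\|_{S^{-1}}^2$ for all $x,y\in\mathcal{H}$. It is $\beta$-Lipschitz with respect to $S$ ($\beta\ge0$) if $\|Tx-Ty\|_{S^{-1}}\le\beta\|x-y\|_S$ for all $x,y\in\mathcal{H}$. Standing assumptions: $A\colon\mathcal{H}\to2^{\mathcal{H}}$ is maximally monotone; $C\colon\mathcal{H}\to\mathcal{H}$ is $\mu$-cocoercive with respect to $S$, with $\mu\in\,]0,+\infty[$; the solution set $\boldsymbol{Z}=\operatorname{zer}(A+C)=\{x\in\mathcal{H}: 0\in Ax+Cx\}$ is nonempty; $\underline{\gamma},\overline{\gamma}\in\,]0,+\infty[$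 and $(\gamma_n)_{n\in\mathbb{N}}$ is a sequence in $[\underline{\gamma},\overline{\gamma}]$; $\varepsilon\in\,]0,1[$; for every $n\in\mathbb{N}$, $M_n\colon\mathcal{H}\to\mathcal{H}$ is a (possibly nonlinear) operator such that $\gamma_nM_n-S$ is $\zeta_n$-Lipschitz with respect to $S$, with $\zeta_n\in[0,1-\varepsilon]$. Under these assumptions $(M_n+A)^{-1}$ is single-valued and defined everywhere, so the recursion is well defined. *)

theory Defs
  imports "HOL-Analysis.Analysis"
begin

text \<open>
  A real Hilbert space is a type of sort \<open>{real_inner, complete_space}\<close>; no separability or
  finite dimensionality is assumed. A set-valued operator \<open>A: H \<rightarrow> 2^H\<close> is a function
  \<open>'a \<Rightarrow> 'a set\<close>.
\<close>

definition self_adjoint :: "('a::real_inner \<Rightarrow> 'a) \<Rightarrow> bool" where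
  "self_adjoint S \<longleftrightarrow> (\<forall>x y. S x \<bullet> y = x \<bullet> S y)"

text \<open>The following is strong monotonicity in the form it takes for linear operators.\<close>

definition strongly_monotone :: "('a::real_inner \<Rightarrow> 'a) \<Rightarrow> bool" where
  "strongly_monotone S \<longleftrightarrow> (\<exists>a>0. \<forall>x. S x \<bullet> x \<ge> a * (norm x)\<^sup>2)"

text \<open>
  Used with \<open>W = S\<close> and \<open>W = inv S\<close>. A bounded linear strongly monotone \<open>S\<close> on a Hilbert space
  is bijective, so \<open>inv S\<close> is then the genuine inverse.
\<close>

definition norm_wrt :: "('a::real_inner \<Rightarrow> 'a) \<Rightarrow> 'a \<Rightarrow> real" where
  "norm_wrt W x = sqrt (W x \<bullet> x)"

definition cocoercive_wrt :: "('a::real_inner \<Rightarrow> 'a) \<Rightarrow> real \<Rightarrow> ('a \<Rightarrow> 'a) \<Rightarrow> bool" where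
  "cocoercive_wrt S b T \<longleftrightarrow>
     (\<forall>x y. (x - y) \<bullet> (T x - T y) \<ge> b * (norm_wrt (inv S) (T x - T y))\<^sup>2)"

definition lipschitz_wrt :: "('a::real_inner \<Rightarrow> 'a) \<Rightarrow> real \<Rightarrow> ('a \<Rightarrow> 'a) \<Rightarrow> bool" where
  "lipschitz_wrt S b T \<longleftrightarrow>
     (\<forall>x y. norm_wrt (inv S) (T x - T y) \<le> b * norm_wrt S (x - y))"

definition monotone_op :: "('a::real_inner \<Rightarrow> 'a set) \<Rightarrow> bool" where
  "monotone_op A \<longleftrightarrow> (\<forall>x y. \<forall>u\<in>A x. \<forall>v\<in>A y. (x - y) \<bullet> (u - v) \<ge> 0)"

definition maximally_monotone :: "('a::real_inner \<Rightarrow> 'a set) \<Rightarrow> bool" where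
  "maximally_monotone A \<longleftrightarrow>
     monotone_op A \<and> (\<forall>B. monotone_op B \<and> (\<forall>x. A x \<subseteq> B x) \<longrightarrow> B = A)"

definition single :: "('a \<Rightarrow> 'a) \<Rightarrow> 'a \<Rightarrow> 'a set" where
  "single T x = {T x}"

definition op_sum :: "('a::plus \<Rightarrow> 'a set) \<Rightarrow> ('a \<Rightarrow> 'a set) \<Rightarrow> 'a \<Rightarrow> 'a set" where
  "op_sum A B x = {a + b |a b. a \<in> A x \<and> b \<in> B x}"

definition op_inv :: "('a \<Rightarrow> 'a set) \<Rightarrow> 'a \<Rightarrow> 'a set" where
  "op_inv A u = {x. u \<in> A x}"

definition zer :: "('a::zero \<Rightarrow> 'a set) \<Rightarrow> 'a set" where
  "zer A = {x. 0 \<in> A x}"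

definition weakly_converges :: "(nat \<Rightarrow> 'a::real_inner) \<Rightarrow> 'a \<Rightarrow> bool" where
  "weakly_converges x p \<longleftrightarrow> (\<forall>w. (\<lambda>n. x n \<bullet> w) \<longlonglongrightarrow> p \<bullet> w)"

text \<open>
  \<open>prev x' x n\<close> is the term \<open>x\<^sub>n\<^sub>-\<^sub>1\<close> of a sequence \<open>x\<close> that starts at index \<open>-1\<close> with value \<open>x'\<close>.
\<close>

definition prev :: "'a \<Rightarrow> (nat \<Rightarrow> 'a) \<Rightarrow> nat \<Rightarrow> 'a" where
  "prev x' x n = (case n of 0 \<Rightarrow> x' | Suc k \<Rightarrow> x k)"

end

theory Submission
  imports Defs
begin

text \<open>
  Write \<open>q v = \<langle>S v, v\<rangle>\<close> and \<open>d n = x n - x (n - 1)\<close>. Multiplying the inclusion that defines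
  \<open>x (n + 1)\<close> by \<open>\<gamma> n\<close> and using the definition of \<open>u (n + 1)\<close> makes the nonlinear kernels
  \<open>M n\<close> disappear: there is \<open>a\<close> in \<open>A (x (n + 1))\<close> with
  \<open>\<gamma> n (a + C (z n)) = S (x n - x (n + 1) + (\<alpha> n + \<theta> n) d n) + u n - u (n + 1)\<close>.
  So the iteration is an inertial forward-backward step in the metric of \<open>S\<close>, with a momentum
  \<open>\<alpha> n + \<theta> n\<close> and with errors that telescope. The kernels enter only through the bound
  of \<open>u (n + 1)\<close> by \<open>\<zeta> n\<close> times the length of \<open>x (n + 1) - y n\<close>.

  Pairing this identity with \<open>x (n + 1) - w\<close> for a zero \<open>w\<close> gives a descent inequality
  (\<open>energy_step\<close>) for the energy \<open>E\<close>, which is \<open>q (x n - w)\<close> plus the telescoping cross term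
  with \<open>u n\<close> plus the multiple of \<open>q (x n - y (n - 1))\<close> that keeps it nonnegative. The
  coefficients of \<open>q (d (n + 1))\<close> and \<open>q (d n)\<close> in it are exactly \<open>- \<eta> n\<close> and \<open>\<xi> n\<close>, and that of
  the second difference has the sign that the first parameter condition prescribes. The second
  condition makes a Lyapunov function decrease by \<open>\<delta> q (d (n + 1))\<close> per step
  (\<open>inertial_descent\<close>). It also forces the momentum below \<open>(1 - \<zeta> (n - 1)) / 2\<close>, which bounds the
  sequence. Hence \<open>q (d n)\<close> is summable, \<open>u n\<close> tends to \<open>0\<close>, and \<open>q (x n - w)\<close> converges, because
  only \<open>q (x (n + 1) - w) - t q (x n - w)\<close> with \<open>t \<le> 1/2\<close> is left of the Lyapunov function
  in the limit.

  The residuals \<open>a + C (x (n + 1))\<close> then tend to \<open>0\<close>, so every weak cluster point is a zero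
  (\<open>weak_cluster_point_in_zer\<close>), and Opial's principle (\<open>opial\<close>) gives weak convergence. It rests
  on weak compactness of bounded sets, proved from Tychonoff's theorem and the Riesz representation.
\<close>

section \<open>Quadratic functionals and the Riesz representation\<close>

lemma form_commute: "self_adjoint S \<Longrightarrow> S v \<bullet> w = S w \<bullet> v"
  by (simp add: self_adjoint_def inner_commute)

text \<open>
  The functional \<open>J v = \<langle>S v, v\<rangle> - 2 L v\<close> is bounded below and uniformly convex, so minimising
  sequences are Cauchy (parallelogram law); the minimiser satisfies the Euler equation. The
  identity for \<open>S\<close> gives the Riesz representation of \<open>L\<close>, and \<open>L = \<langle>f, \<cdot>\<rangle>\<close> gives surjectivity
  of \<open>S\<close>.
\<close>

lemma symmetric_lax_milgram:
  fixes S :: "'a::{real_inner, complete_space} \<Rightarrow> 'a" and L :: "'a \<Rightarrow> real"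
  assumes blS: "bounded_linear S" and sa: "self_adjoint S" and sm: "strongly_monotone S"
    and blL: "bounded_linear L"
  shows "\<exists>p. \<forall>w. S p \<bullet> w = L w"
proof -
  interpret S: bounded_linear S by fact
  interpret L: bounded_linear L by fact
  obtain a where a: "a > 0" and amon: "\<And>v. S v \<bullet> v \<ge> a * (norm v)\<^sup>2"
    using sm unfolding strongly_monotone_def by blast
  obtain K where K: "K > 0" and LK: "\<And>v. norm (L v) \<le> norm v * K"
    using L.pos_bounded by blast
  define J where "J v = S v \<bullet> v - 2 * L v" for v
  have lower: "- (K\<^sup>2 / a) \<le> J v" for v
  proof -
    have "L v \<le> norm v * K" using LK[of v] by simp
    moreover have "0 \<le> (a * norm v - K)\<^sup>2 / a" using a by simp
    moreover have "(a * norm v - K)\<^sup>2 / a = a * (norm v)\<^sup>2 - 2 * (norm v * K) + K\<^sup>2 / a"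
      using a by (simp add: power2_eq_square field_simps)
    ultimately show ?thesis using amon[of v] unfolding J_def by linarith
  qed
  define m where "m = (INF v. J v)"
  have bdd: "bdd_below (range J)" using lower by (auto intro!: bdd_belowI)
  have m_le: "m \<le> J v" for v unfolding m_def by (rule cINF_lower[OF bdd]) simp
  have "\<exists>v. J v < m + 1 / real (Suc n)" for n
  proof -
    have "Inf (range J) < m + 1 / real (Suc n)" unfolding m_def by simp
    then show ?thesis using cInf_lessD[of "range J"] by auto
  qed
  then obtain v where v: "\<And>n. J (v n) < m + 1 / real (Suc n)" by metis
  have par: "a / 2 * (norm (s - t))\<^sup>2 \<le> (J s - m) + (J t - m)" for s t
  proof -
    have sc: "S s \<bullet> t = S t \<bullet> s" by (rule form_commute[OF sa])
    have "J s + J t - 2 * J ((1/2) *\<^sub>R (s + t)) = (1/2) * (S (s - t) \<bullet> (s - t))"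
      unfolding J_def
      by (simp add: S.add S.diff S.scaleR L.add L.diff L.scaleR inner_add_left inner_add_right
          inner_diff_left inner_diff_right sc algebra_simps)
    with m_le[of "(1/2) *\<^sub>R (s + t)"] amon[of "s - t"] show ?thesis by linarith
  qed
  have "Cauchy v"
  proof (rule metric_CauchyI)
    fix e :: real assume e: "e > 0"
    have "0 < a * e\<^sup>2 / 4" using a e by simp
    then obtain M where M: "1 / real (Suc M) < a * e\<^sup>2 / 4"
      using nat_approx_posE by blast
    show "\<exists>M. \<forall>i\<ge>M. \<forall>n\<ge>M. dist (v i) (v n) < e"
    proof (intro exI[of _ M] allI impI)
      fix i n assume "M \<le> i" "M \<le> n"
      then have "1 / real (Suc i) \<le> 1 / real (Suc M)" "1 / real (Suc n) \<le> 1 / real (Suc M)"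
        by (auto simp: field_simps)
      then have "a / 2 * (norm (v i - v n))\<^sup>2 < a / 2 * e\<^sup>2"
        using par[of "v i" "v n"] v[of i] v[of n] M by linarith
      then have "(norm (v i - v n))\<^sup>2 < e\<^sup>2" using a by simp
      then show "dist (v i) (v n) < e"
        using e by (simp add: dist_norm power2_less_imp_less)
    qed
  qed
  then obtain p where p: "v \<longlonglongrightarrow> p" using Cauchy_convergent convergent_def by blast
  have "(\<lambda>n. J (v n)) \<longlonglongrightarrow> J p"
    unfolding J_def by (intro tendsto_intros S.tendsto L.tendsto p)
  moreover have "(\<lambda>n. m + 1 / real (Suc n)) \<longlonglongrightarrow> m + 0"
    by (intro tendsto_intros LIMSEQ_Suc[OF lim_1_over_n])
  ultimately have Jp: "J p \<le> m"
    using LIMSEQ_le[of "\<lambda>n. J (v n)" "J p" "\<lambda>n. m + 1 / real (Suc n)" "m + 0"] v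
    by (auto intro: less_imp_le)
  have "S p \<bullet> w = L w" for w
  proof (rule ccontr)
    assume ne: "S p \<bullet> w \<noteq> L w"
    define c where "c = S p \<bullet> w - L w"
    have c: "c \<noteq> 0" using ne by (simp add: c_def)
    have w: "w \<noteq> 0" using ne by (auto simp: L.zero)
    have Q: "S w \<bullet> w > 0"
      using amon[of w] a w by (meson less_le_trans mult_pos_pos zero_less_norm_iff zero_less_power)
    \<comment> \<open>\<open>t\<close> minimises \<open>J\<close> on the line through \<open>p\<close> in the direction \<open>w\<close>.\<close>
    define t where "t = - c / (S w \<bullet> w)"
    have "J (p + t *\<^sub>R w) = J p + 2 * t * c + t\<^sup>2 * (S w \<bullet> w)"
      unfolding J_def c_def using form_commute[OF sa, of p w]
      by (simp add: S.add S.scaleR L.add L.scaleR inner_add_left inner_add_right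
          power2_eq_square algebra_simps)
    also have "\<dots> = J p - c\<^sup>2 / (S w \<bullet> w)"
      unfolding t_def using Q by (simp add: power2_eq_square field_simps)
    also have "\<dots> < m" using Jp Q c by (smt (verit) divide_pos_pos zero_less_power2)
    finally show False using m_le[of "p + t *\<^sub>R w"] by simp
  qed
  then show ?thesis by blast
qed

lemma riesz_representation:
  fixes L :: "'a::{real_inner, complete_space} \<Rightarrow> real"
  assumes "bounded_linear L"
  shows "\<exists>p. \<forall>w. p \<bullet> w = L w"
proof -
  have "strongly_monotone (\<lambda>v::'a. v)"
    unfolding strongly_monotone_def by (auto simp: power2_norm_eq_inner intro!: exI[of _ 1])
  with symmetric_lax_milgram[of "\<lambda>v. v" L] assms show ?thesis
    by (simp add: self_adjoint_def bounded_linear_ident)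
qed

section \<open>Weak convergence along filters\<close>

text \<open>
  Convergence is along filters rather than along subsequences, so that a cluster point of a
  possibly non-metrisable product topology, as Tychonoff's theorem yields it, can be used directly.
\<close>

definition weakly_tendsto :: "('i \<Rightarrow> 'a::real_inner) \<Rightarrow> 'a \<Rightarrow> 'i filter \<Rightarrow> bool" where
  "weakly_tendsto x p F \<longleftrightarrow> (\<forall>w. ((\<lambda>i. x i \<bullet> w) \<longlongrightarrow> p \<bullet> w) F)"

lemma weakly_tendstoD: "weakly_tendsto x p F \<Longrightarrow> ((\<lambda>i. x i \<bullet> w) \<longlongrightarrow> p \<bullet> w) F"
  by (simp add: weakly_tendsto_def)

text \<open>
  The functionals \<open>w \<mapsto> \<langle>x i, w\<rangle>\<close> lie in a product of compact intervals, hence cluster pointwise;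
  a pointwise limit is again linear and bounded, and Riesz turns it into a point.
\<close>

lemma bounded_imp_weak_cluster_point:
  fixes x :: "'i \<Rightarrow> 'a::{real_inner, complete_space}"
  assumes F: "F \<noteq> bot" and B: "\<And>i. norm (x i) \<le> B"
  shows "\<exists>G p. G \<le> F \<and> G \<noteq> bot \<and> weakly_tendsto x p G"
proof -
  define f where "f i = (\<lambda>w. x i \<bullet> w)" for i
  define U :: "('a \<Rightarrow> real) set" where "U = PiE UNIV (\<lambda>w. {- (B * norm w)..B * norm w})"
  have "compact U"
    using compactin_PiE[of "\<lambda>_::'a. euclidean :: real topology" UNIV
        "\<lambda>w. {- (B * norm w)..B * norm w}"]
    by (simp add: U_def euclidean_product_topology)
  have bound: "\<bar>x i \<bullet> w\<bar> \<le> B * norm w" for i w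
    using Cauchy_Schwarz_ineq2[of "x i" w] mult_right_mono[OF B norm_ge_zero] by (rule order_trans)
  then have "f i \<in> U" for i
    unfolding U_def f_def by (auto simp: abs_le_iff minus_le_iff)
  then have "eventually (\<lambda>g. g \<in> U) (filtermap f F)" by (simp add: eventually_filtermap)
  moreover have "filtermap f F \<noteq> bot" using F by (simp add: filtermap_bot_iff)
  ultimately obtain L where L: "inf (nhds L) (filtermap f F) \<noteq> bot"
    using \<open>compact U\<close> unfolding compact_filter by blast
  define G where "G = inf (filtercomap f (nhds L)) F"
  have Gbot: "G \<noteq> bot"
  proof
    assume "G = bot"
    then have "eventually (\<lambda>_. False) G" by simp
    then obtain P Q where P: "eventually P (nhds L)" and Q: "eventually Q F"
      and PQ: "\<And>i. P (f i) \<Longrightarrow> Q i \<Longrightarrow> False"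
      unfolding G_def eventually_inf eventually_filtercomap by blast
    have "eventually (\<lambda>g. \<not> P g) (filtermap f F)"
      unfolding eventually_filtermap using Q by (rule eventually_mono) (use PQ in blast)
    with P have "eventually (\<lambda>_. False) (inf (nhds L) (filtermap f F))"
      unfolding eventually_inf by (metis (no_types, lifting))
    then show False using L by (simp add: trivial_limit_def)
  qed
  have lim: "((\<lambda>i. x i \<bullet> w) \<longlongrightarrow> L w) G" for w
  proof -
    have "filterlim f (nhds L) G"
      unfolding filterlim_def G_def filtermap_le_iff_le_filtercomap by simp
    moreover have "filterlim (\<lambda>g::'a \<Rightarrow> real. g w) (nhds (L w)) (nhds L)"
    proof (rule topological_tendstoI)
      fix T :: "real set" assume T: "open T" "L w \<in> T"
      have "open ((\<lambda>g::'a \<Rightarrow> real. g w) -` T)"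
        by (intro open_vimage T continuous_on_product_coordinates)
      then show "eventually (\<lambda>g. g w \<in> T) (nhds L)"
        using T(2) eventually_nhds_in_open[of "(\<lambda>g::'a \<Rightarrow> real. g w) -` T" L] by simp
    qed
    ultimately have "((\<lambda>i. f i w) \<longlongrightarrow> L w) G" by (rule filterlim_compose[rotated])
    then show ?thesis by (simp add: f_def)
  qed
  have "bounded_linear L"
  proof (rule bounded_linear_intro)
    fix v w
    have "((\<lambda>i. x i \<bullet> v + x i \<bullet> w) \<longlongrightarrow> L v + L w) G" by (intro tendsto_intros lim)
    then show "L (v + w) = L v + L w"
      using tendsto_unique[OF Gbot lim[of "v + w"]] by (simp add: inner_add_right)
  next
    fix r v
    have "((\<lambda>i. r * (x i \<bullet> v)) \<longlongrightarrow> r * L v) G" by (intro tendsto_intros lim)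
    then show "L (r *\<^sub>R v) = r *\<^sub>R L v"
      using tendsto_unique[OF Gbot lim[of "r *\<^sub>R v"]] by simp
  next
    fix v
    have "\<bar>L v\<bar> \<le> B * norm v"
      using bound by (intro tendsto_upperbound[OF tendsto_rabs[OF lim] _ Gbot] always_eventually) auto
    then show "norm (L v) \<le> norm v * B" by (simp add: mult.commute)
  qed
  then obtain p where "\<forall>w. p \<bullet> w = L w" using riesz_representation by blast
  then have "weakly_tendsto x p G" using lim by (simp add: weakly_tendsto_def)
  moreover have "G \<le> F" by (simp add: G_def)
  ultimately show ?thesis using Gbot by blast
qed

lemma inner_tendsto_weak_strong:
  assumes x: "weakly_tendsto x p F" and B: "\<And>i. norm (x i) \<le> B" and v: "(v \<longlongrightarrow> v0) F"
  shows "((\<lambda>i. x i \<bullet> v i) \<longlongrightarrow> p \<bullet> v0) F"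
proof -
  have "((\<lambda>i. B * norm (v i - v0)) \<longlongrightarrow> B * 0) F"
    by (intro tendsto_intros tendsto_norm_zero) (use v in \<open>simp add: LIM_zero_iff\<close>)
  then have lim0: "((\<lambda>i. B * norm (v i - v0)) \<longlongrightarrow> 0) F" by simp
  have "norm (x i \<bullet> (v i - v0)) \<le> B * norm (v i - v0)" for i
    using Cauchy_Schwarz_ineq2[of "x i" "v i - v0"] mult_right_mono[OF B norm_ge_zero]
    by (simp, rule order_trans)
  then have "((\<lambda>i. x i \<bullet> (v i - v0)) \<longlongrightarrow> 0) F"
    by (intro Lim_null_comparison[OF always_eventually lim0]) simp
  from tendsto_add[OF this weakly_tendstoD[OF x, of v0]] show ?thesis
    by (simp add: inner_diff_right)
qed

section \<open>Weak cluster points of approximate zeros\<close>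

text \<open>
  A pair that is monotonically related to the whole graph can be added to it, so by maximality it
  is already there.
\<close>

lemma maximally_monotone_memI:
  assumes A: "maximally_monotone A"
    and rel: "\<And>t b. b \<in> A t \<Longrightarrow> (p - t) \<bullet> (v - b) \<ge> 0"
  shows "v \<in> A p"
proof -
  define B where "B = A(p := insert v (A p))"
  have mono: "\<And>s t b c. b \<in> A s \<Longrightarrow> c \<in> A t \<Longrightarrow> (s - t) \<bullet> (b - c) \<ge> 0"
    using A unfolding maximally_monotone_def monotone_op_def by blast
  have rel': "(t - p) \<bullet> (b - v) \<ge> 0" if "b \<in> A t" for t b
    using rel[OF that] by (simp add: inner_diff_left inner_diff_right)
  have "monotone_op B"
    unfolding monotone_op_def B_def
    by (auto split: if_splits intro: mono rel rel')
  then have "B = A"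
    using A unfolding maximally_monotone_def B_def by auto
  then show ?thesis unfolding B_def by (metis fun_upd_same insertI1)
qed

lemma zer_sum_iff:
  fixes C :: "'a::ab_group_add \<Rightarrow> 'a"
  shows "w \<in> zer (op_sum A (single C)) \<longleftrightarrow> - C w \<in> A w"
  unfolding zer_def op_sum_def single_def
  by (auto simp: add_eq_0_iff2 intro!: exI[of _ "- C w"])

text \<open>
  Pairing the approximate zeros with an exact zero \<open>w\<close> and using cocoercivity shows that
  \<open>C (x i)\<close> converges strongly to \<open>C w\<close>. Cocoercivity between \<open>x i\<close> and \<open>p\<close> then identifies this
  limit as \<open>C p\<close>. So \<open>b i\<close> converges strongly to \<open>- C p\<close>, and the weak-strong closedness of the
  graph of \<open>A\<close> finishes the argument.
\<close>

lemma weak_cluster_point_in_zer: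
  fixes x :: "'i \<Rightarrow> 'a::real_inner"
  assumes A: "maximally_monotone A"
    and \<nu>: "\<nu> > 0" and coco: "\<And>s t. (s - t) \<bullet> (C s - C t) \<ge> \<nu> * (norm (C s - C t))\<^sup>2"
    and w: "w \<in> zer (op_sum A (single C))"
    and F: "F \<noteq> bot" and B: "\<And>i. norm (x i) \<le> B"
    and b: "eventually (\<lambda>i. b i \<in> A (x i)) F"
    and bC: "((\<lambda>i. b i + C (x i)) \<longlongrightarrow> 0) F"
    and x: "weakly_tendsto x p F"
  shows "p \<in> zer (op_sum A (single C))"
proof -
  have mono: "\<And>s t b c. b \<in> A s \<Longrightarrow> c \<in> A t \<Longrightarrow> (s - t) \<bullet> (b - c) \<ge> 0"
    using A unfolding maximally_monotone_def monotone_op_def by blast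
  have Aw: "- C w \<in> A w" using w by (simp add: zer_sum_iff)
  have sq: "((\<lambda>i. C (x i)) \<longlongrightarrow> c) F"
    if l: "((\<lambda>i. (norm (C (x i) - c))\<^sup>2) \<longlongrightarrow> 0) F" for c
  proof -
    have "((\<lambda>i. sqrt ((norm (C (x i) - c))\<^sup>2)) \<longlongrightarrow> sqrt 0) F" by (intro tendsto_intros l)
    then have "((\<lambda>i. C (x i) - c) \<longlongrightarrow> 0) F" by (simp add: tendsto_norm_zero_iff)
    then show ?thesis by (simp add: LIM_zero_iff)
  qed
  have coco': "(norm (C s - C t))\<^sup>2 \<le> (1 / \<nu>) * ((s - t) \<bullet> (C s - C t))" for s t
    using coco[of s t] \<nu> by (simp add: field_simps)
  have "((\<lambda>i. (1 / \<nu>) * (x i \<bullet> (b i + C (x i)) - w \<bullet> (b i + C (x i)))) \<longlongrightarrow>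
      (1 / \<nu>) * (p \<bullet> 0 - w \<bullet> 0)) F"
    by (intro tendsto_intros inner_tendsto_weak_strong[OF x B bC] bC)
  then have lim0: "((\<lambda>i. (1 / \<nu>) * ((x i - w) \<bullet> (b i + C (x i)))) \<longlongrightarrow> 0) F"
    by (simp add: inner_diff_left)
  have "eventually (\<lambda>i. norm ((norm (C (x i) - C w))\<^sup>2)
      \<le> (1 / \<nu>) * ((x i - w) \<bullet> (b i + C (x i)))) F"
    using b
  proof eventually_elim
    case (elim i)
    have "0 \<le> (x i - w) \<bullet> (b i - (- C w))" using mono[OF elim Aw] .
    then have "(x i - w) \<bullet> (C (x i) - C w) \<le> (x i - w) \<bullet> (b i + C (x i))"
      by (simp add: inner_add_right inner_diff_right)
    then have "(1 / \<nu>) * ((x i - w) \<bullet> (C (x i) - C w)) \<le> (1 / \<nu>) * ((x i - w) \<bullet> (b i + C (x i)))"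
      using \<nu> by (intro mult_left_mono) auto
    with coco'[of "x i" w] show ?case by simp
  qed
  then have Cw: "((\<lambda>i. C (x i)) \<longlongrightarrow> C w) F"
    by (rule sq[OF Lim_null_comparison[OF _ lim0]])
  have "((\<lambda>i. (1 / \<nu>) * ((x i \<bullet> (C (x i) - C p)) - p \<bullet> (C (x i) - C p))) \<longlongrightarrow>
      (1 / \<nu>) * (p \<bullet> (C w - C p) - p \<bullet> (C w - C p))) F"
    by (intro tendsto_intros inner_tendsto_weak_strong[OF x B] Cw)
  then have "((\<lambda>i. (1 / \<nu>) * ((x i - p) \<bullet> (C (x i) - C p))) \<longlongrightarrow> 0) F"
    by (simp add: inner_diff_left)
  then have "((\<lambda>i. (norm (C (x i) - C p))\<^sup>2) \<longlongrightarrow> 0) F"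
    by (rule Lim_null_comparison[rotated]) (simp add: coco'[simplified])
  then have Cp: "C p = C w" using tendsto_unique[OF F sq Cw] by blast
  have "((\<lambda>i. (b i + C (x i)) - C (x i)) \<longlongrightarrow> 0 - C w) F" by (intro tendsto_intros bC Cw)
  then have bl: "(b \<longlongrightarrow> - C p) F" by (simp add: Cp)
  have "- C p \<in> A p"
  proof (rule maximally_monotone_memI[OF A])
    fix t c assume c: "c \<in> A t"
    have "((\<lambda>i. x i \<bullet> (b i - c) - t \<bullet> (b i - c)) \<longlongrightarrow> p \<bullet> (- C p - c) - t \<bullet> (- C p - c)) F"
      by (intro tendsto_intros inner_tendsto_weak_strong[OF x B] bl)
    then have "((\<lambda>i. (x i - t) \<bullet> (b i - c)) \<longlongrightarrow> (p - t) \<bullet> (- C p - c)) F"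
      by (simp add: inner_diff_left)
    moreover have "eventually (\<lambda>i. 0 \<le> (x i - t) \<bullet> (b i - c)) F"
      using b by eventually_elim (rule mono[OF _ c])
    ultimately show "0 \<le> (p - t) \<bullet> (- C p - c)"
      using tendsto_lowerbound F by blast
  qed
  then show ?thesis by (simp add: zer_sum_iff)
qed

section \<open>The geometry of a strongly monotone self-adjoint operator\<close>

locale hilbert_metric =
  fixes S :: "'a::{real_inner, complete_space} \<Rightarrow> 'a"
  assumes bounded_linear_S: "bounded_linear S"
    and self_adjoint_S: "self_adjoint S"
    and strongly_monotone_S: "strongly_monotone S"
begin

text \<open>
  \<open>q\<close> and \<open>q_dual\<close> are the squares of the two weighted norms. Unlike the norms they are
  quadratic, so that the estimates below are polynomial identities plus signs.
\<close>

definition q :: "'a \<Rightarrow> real" where "q v = S v \<bullet> v"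

definition q_dual :: "'a \<Rightarrow> real" where "q_dual v = inv S v \<bullet> v"

interpretation S: bounded_linear S by (rule bounded_linear_S)

lemmas S_linear = S.add S.diff S.neg S.scaleR S.zero

lemma S_inner_commute: "S v \<bullet> w = S w \<bullet> v"
  by (rule form_commute[OF self_adjoint_S])

lemma q_coercive: "\<exists>a>0. \<forall>v. a * (norm v)\<^sup>2 \<le> q v"
  using strongly_monotone_S by (simp add: strongly_monotone_def q_def)

lemma q_nonneg [simp]: "0 \<le> q v"
proof -
  obtain a where "a > 0" "a * (norm v)\<^sup>2 \<le> q v" using q_coercive by blast
  moreover from \<open>a > 0\<close> have "0 \<le> a * (norm v)\<^sup>2" by simp
  ultimately show ?thesis by linarith
qed

lemma q_eq_0_iff [simp]: "q v = 0 \<longleftrightarrow> v = 0"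
proof
  obtain a where "a > 0" "a * (norm v)\<^sup>2 \<le> q v" using q_coercive by blast
  moreover assume "q v = 0"
  ultimately have "a * (norm v)\<^sup>2 \<le> 0" by simp
  then show "v = 0" using \<open>a > 0\<close> by (simp add: mult_le_0_iff)
qed (simp add: q_def S.zero)

lemma q_zero [simp]: "q 0 = 0"
  by simp

lemma surj_S: "surj S"
  unfolding surj_def
proof
  fix f
  obtain p where p: "\<And>w. S p \<bullet> w = f \<bullet> w"
    using symmetric_lax_milgram[OF bounded_linear_S self_adjoint_S strongly_monotone_S
        bounded_linear_inner_right[of f]] by blast
  have "(S p - f) \<bullet> (S p - f) = 0" using p[of "S p - f"] by (simp add: inner_diff_left)
  then show "\<exists>p. f = S p" by (intro exI[of _ p]) simp
qed

lemma S_inv_S [simp]: "S (inv S v) = v"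
  by (rule surj_f_inv_f[OF surj_S])

lemma q_dual_eq: "q_dual v = q (inv S v)"
  by (simp add: q_dual_def q_def inner_commute)

lemma q_dual_coercive: "\<exists>b>0. \<forall>v. b * (norm v)\<^sup>2 \<le> q_dual v"
proof -
  obtain K where K: "K > 0" "\<And>v. norm (S v) \<le> norm v * K" using S.pos_bounded by blast
  obtain a where a: "a > 0" "\<And>v. a * (norm v)\<^sup>2 \<le> q v" using q_coercive by blast
  have "a / K\<^sup>2 * (norm v)\<^sup>2 \<le> q_dual v" for v
  proof -
    have "norm v \<le> norm (inv S v) * K" using K(2)[of "inv S v"] by simp
    then have "(norm v)\<^sup>2 \<le> (norm (inv S v))\<^sup>2 * K\<^sup>2"
      using power_mono[of "norm v" "norm (inv S v) * K" 2] by (simp add: power_mult_distrib)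
    then have "a / K\<^sup>2 * (norm v)\<^sup>2 \<le> a / K\<^sup>2 * ((norm (inv S v))\<^sup>2 * K\<^sup>2)"
      using a(1) by (intro mult_left_mono) auto
    also have "\<dots> = a * (norm (inv S v))\<^sup>2" using K(1) by simp
    also have "\<dots> \<le> q_dual v" using a(2)[of "inv S v"] by (simp add: q_dual_eq)
    finally show ?thesis .
  qed
  moreover have "a / K\<^sup>2 > 0" using a(1) K(1) by simp
  ultimately show ?thesis by blast
qed

lemma norm_wrt_S_sq: "(norm_wrt S v)\<^sup>2 = q v"
  using q_nonneg[of v] by (simp add: norm_wrt_def q_def)

lemma norm_wrt_inv_S_sq: "(norm_wrt (inv S) v)\<^sup>2 = q_dual v"
  using q_nonneg[of "inv S v"] unfolding norm_wrt_def by (simp add: q_dual_def[symmetric] q_dual_eq)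

text \<open>Young's inequality for the dual pair of norms holds because \<open>q (c v - S\<inverse> f)\<close> is nonnegative.\<close>

lemma young_dual:
  assumes c: "c > 0"
  shows "2 * (v \<bullet> f) \<le> c * q v + q_dual f / c"
proof -
  have "q (c *\<^sub>R v - inv S f) = c\<^sup>2 * q v - 2 * c * (v \<bullet> f) + q_dual f"
    unfolding q_dual_eq q_def using S_inner_commute[of "inv S f" v]
      inner_commute[of f v] inner_commute[of f "inv S f"]
    by (simp add: S_linear inner_diff_left inner_diff_right power2_eq_square distrib_left
        right_diff_distrib)
  then have "0 \<le> (c\<^sup>2 * q v - 2 * c * (v \<bullet> f) + q_dual f) / c"
    using q_nonneg[of "c *\<^sub>R v - inv S f"] c by simp
  also have "\<dots> = c * q v - 2 * (v \<bullet> f) + q_dual f / c"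
    using c by (simp add: power2_eq_square field_simps)
  finally show ?thesis by simp
qed

text \<open>
  Young's inequality with weight \<open>l\<close>. The bound forces \<open>f = 0\<close> in the degenerate case \<open>l = 0\<close>.
\<close>

lemma young_lipschitz:
  assumes l: "0 \<le> l" and f: "q_dual f \<le> l\<^sup>2 * r"
  shows "2 * \<bar>v \<bullet> f\<bar> \<le> l * (q v + r)"
proof (cases "l = 0")
  case True
  obtain b where "b > 0" "b * (norm f)\<^sup>2 \<le> q_dual f" using q_dual_coercive by blast
  with f True have "b * (norm f)\<^sup>2 \<le> 0" by simp
  then have "f = 0" using \<open>b > 0\<close> by (simp add: mult_le_0_iff)
  then show ?thesis using True by simp
next
  case False
  then have l: "l > 0" using l by simp
  have "q_dual f / l \<le> l * r" using f l by (simp add: field_simps power2_eq_square)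
  moreover have "- (2 * (v \<bullet> f)) \<le> l * q v + q_dual f / l"
    using young_dual[OF l, of "- v" f] by (simp add: q_def S_linear)
  ultimately show ?thesis
    using young_dual[OF l, of v f] distrib_left[of l "q v" r] by linarith
qed

lemma q_polarization: "2 * (S a \<bullet> b) = q a + q b - q (a - b)"
  unfolding q_def using S_inner_commute[of b a]
  by (simp add: S_linear inner_diff_left inner_diff_right)

text \<open>
  The exact convexity defect of \<open>q\<close> on the line through \<open>a\<close> and \<open>a - b\<close>. With \<open>a\<close> and \<open>b\<close> two
  successive increments, it resolves the distance to an extrapolated point into the two increments
  and their difference.
\<close>

lemma q_segment: "q (a - t *\<^sub>R b) = (1 - t) * q a + t * q (a - b) - t * (1 - t) * q b"
  unfolding q_def using S_inner_commute[of b a]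
  by (simp add: S_linear inner_diff_left inner_diff_right power2_eq_square algebra_simps)

lemma q_tendsto_0_imp:
  assumes "((\<lambda>i. q (v i)) \<longlongrightarrow> 0) F"
  shows "(v \<longlongrightarrow> 0) F"
proof -
  obtain a where a: "a > 0" "\<And>v. a * (norm v)\<^sup>2 \<le> q v" using q_coercive by blast
  have "((\<lambda>i. q (v i) / a) \<longlongrightarrow> 0) F"
    by (rule tendsto_divide_zero[OF assms])
  from tendsto_real_sqrt[OF this] have lim0: "((\<lambda>i. sqrt (q (v i) / a)) \<longlongrightarrow> 0) F" by simp
  have "norm (v i) \<le> sqrt (q (v i) / a)" for i
    using a(2)[of "v i"] a(1) by (intro real_le_rsqrt) (simp add: pos_le_divide_eq mult.commute)
  then show ?thesis by (intro Lim_null_comparison[OF always_eventually lim0]) simp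
qed

lemma q_dual_tendsto_0_imp:
  assumes "((\<lambda>i. q_dual (v i)) \<longlongrightarrow> 0) F"
  shows "(v \<longlongrightarrow> 0) F"
proof -
  have "((\<lambda>i. inv S (v i)) \<longlongrightarrow> 0) F"
    by (rule q_tendsto_0_imp) (use assms in \<open>simp add: q_dual_eq\<close>)
  from S.tendsto[OF this] show ?thesis by (simp add: S.zero)
qed

lemma q_tendsto:
  assumes "(v \<longlongrightarrow> l) F"
  shows "((\<lambda>i. q (v i)) \<longlongrightarrow> q l) F"
  unfolding q_def by (intro tendsto_intros S.tendsto assms)

lemma q_diff_tendsto_0:
  assumes d: "((\<lambda>i. v i - v' i) \<longlongrightarrow> 0) F"
    and B: "\<And>i. norm (v i) \<le> B" "\<And>i. norm (v' i) \<le> B"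
  shows "((\<lambda>i. q (v i) - q (v' i)) \<longlongrightarrow> 0) F"
proof (rule Lim_null_comparison[OF always_eventually])
  have "((\<lambda>i. norm (S (v i - v' i)) * (2 * B)) \<longlongrightarrow> norm (S 0) * (2 * B)) F"
    by (intro tendsto_intros S.tendsto d)
  then show "((\<lambda>i. norm (S (v i - v' i)) * (2 * B)) \<longlongrightarrow> 0) F" by (simp add: S.zero)
  show "\<forall>i. norm (q (v i) - q (v' i)) \<le> norm (S (v i - v' i)) * (2 * B)"
  proof
    fix i
    have "q (v i) - q (v' i) = S (v i - v' i) \<bullet> (v i + v' i)"
      unfolding q_def using S_inner_commute[of "v i" "v' i"]
      by (simp add: S_linear inner_diff_left inner_add_right)
    then have "norm (q (v i) - q (v' i)) \<le> norm (S (v i - v' i)) * norm (v i + v' i)"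
      using Cauchy_Schwarz_ineq2 by (metis real_norm_def)
    also have "\<dots> \<le> norm (S (v i - v' i)) * (2 * B)"
      using norm_triangle_ineq[of "v i" "v' i"] B(1)[of i] B(2)[of i]
      by (intro mult_left_mono) auto
    finally show "norm (q (v i) - q (v' i)) \<le> norm (S (v i - v' i)) * (2 * B)" .
  qed
qed

text \<open>
  Opial's principle. For two weak cluster points \<open>p\<close> and \<open>p'\<close>, the difference of the convergent
  sequences \<open>q (x n - p)\<close> and \<open>q (x n - p')\<close> is affine in \<open>x n\<close>; its limit can be computed
  along either cluster filter, and comparing the two values gives \<open>q (p - p') = 0\<close>.
\<close>

lemma opial:
  fixes x :: "nat \<Rightarrow> 'a"
  assumes B: "\<And>n. norm (x n) \<le> B"
    and conv: "\<And>w. w \<in> Z \<Longrightarrow> convergent (\<lambda>n. q (x n - w))"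
    and cluster: "\<And>G p. G \<le> sequentially \<Longrightarrow> G \<noteq> bot \<Longrightarrow> weakly_tendsto x p G \<Longrightarrow> p \<in> Z"
  shows "\<exists>p\<in>Z. weakly_converges x p"
proof -
  have uniq: "p = p'"
    if G: "G \<le> sequentially" "G \<noteq> bot" "weakly_tendsto x p G"
      and G': "G' \<le> sequentially" "G' \<noteq> bot" "weakly_tendsto x p' G'" for G G' p p'
  proof -
    obtain l l' where l: "(\<lambda>n. q (x n - p)) \<longlonglongrightarrow> l" and l': "(\<lambda>n. q (x n - p')) \<longlonglongrightarrow> l'"
      using conv[OF cluster[OF G]] conv[OF cluster[OF G']] unfolding convergent_def by blast
    define f where "f n = q (x n - p) - q (x n - p')" for n
    have f: "f \<longlonglongrightarrow> l - l'" unfolding f_def by (intro tendsto_intros l l')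
    have f_eq: "f = (\<lambda>n. - 2 * (x n \<bullet> S (p - p')) + (q p - q p'))"
    proof
      fix n
      show "f n = - 2 * (x n \<bullet> S (p - p')) + (q p - q p')"
        unfolding f_def q_def using S_inner_commute[of "x n" p] S_inner_commute[of "x n" p']
          inner_commute[of "x n" "S p"] inner_commute[of "x n" "S p'"]
        by (simp add: S_linear inner_diff_left inner_diff_right)
    qed
    have lim: "l - l' = - 2 * (r \<bullet> S (p - p')) + (q p - q p')"
      if "H \<le> sequentially" "H \<noteq> bot" "weakly_tendsto x r H" for H r
    proof (rule tendsto_unique[OF that(2)])
      show "(f \<longlongrightarrow> l - l') H" by (rule tendsto_mono[OF that(1) f])
      show "(f \<longlongrightarrow> - 2 * (r \<bullet> S (p - p')) + (q p - q p')) H"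
        unfolding f_eq by (intro tendsto_intros weakly_tendstoD that)
    qed
    have "(p - p') \<bullet> S (p - p') = 0"
      using lim[OF G] lim[OF G'] by (simp add: inner_diff_left)
    then have "q (p - p') = 0" by (simp add: q_def inner_commute)
    then show ?thesis by simp
  qed
  obtain G p where G: "G \<le> sequentially" "G \<noteq> bot" "weakly_tendsto x p G"
    using bounded_imp_weak_cluster_point[of sequentially x B] B by auto
  have "(\<lambda>n. x n \<bullet> w) \<longlonglongrightarrow> p \<bullet> w" for w
  proof (rule ccontr)
    assume "\<not> (\<lambda>n. x n \<bullet> w) \<longlonglongrightarrow> p \<bullet> w"
    then obtain e where e: "e > 0"
      and ne: "\<not> eventually (\<lambda>n. dist (x n \<bullet> w) (p \<bullet> w) < e) sequentially"
      unfolding tendsto_iff by blast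
    define F where "F = inf sequentially (principal {n. \<not> dist (x n \<bullet> w) (p \<bullet> w) < e})"
    have "F \<noteq> bot"
      using ne by (auto simp: F_def trivial_limit_def eventually_inf_principal)
    then obtain G' p' where G': "G' \<le> F" "G' \<noteq> bot" "weakly_tendsto x p' G'"
      using bounded_imp_weak_cluster_point[of F x B] B by auto
    have "G' \<le> sequentially" using G'(1) by (simp add: F_def)
    with G' uniq[OF G] have "weakly_tendsto x p G'" by blast
    then have "eventually (\<lambda>n. dist (x n \<bullet> w) (p \<bullet> w) < e) G'"
      using e by (intro tendstoD weakly_tendstoD)
    moreover have "eventually (\<lambda>n. \<not> dist (x n \<bullet> w) (p \<bullet> w) < e) G'"
      by (rule filter_leD[OF G'(1)]) (simp add: F_def eventually_inf_principal)
    ultimately have "eventually (\<lambda>_. False) G'" by eventually_elim simp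
    then show False using G'(2) by (simp add: trivial_limit_def)
  qed
  then have "weakly_converges x p" by (simp add: weakly_converges_def)
  then show ?thesis using cluster[OF G] by blast
qed

section \<open>The energy inequality of one step\<close>

text \<open>
  The energy of the iterate \<open>v\<close> relative to a zero \<open>w\<close>, where \<open>f\<close> is the current correction term,
  \<open>l\<close> its Lipschitz constant and \<open>r\<close> the squared length of the step that produced it. The
  last term compensates the cross term: since \<open>q_dual f \<le> l\<^sup>2 * r\<close>, the energy is nonnegative when
  \<open>l \<le> 1\<close>.
\<close>

definition energy :: "'a \<Rightarrow> 'a \<Rightarrow> 'a \<Rightarrow> real \<Rightarrow> real \<Rightarrow> real" where
  "energy w v f l r = q (v - w) + 2 * ((v - w) \<bullet> f) + l * r"

lemma energy_lower:
  assumes "0 \<le> l" "q_dual f \<le> l\<^sup>2 * r"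
  shows "(1 - l) * q (v - w) \<le> energy w v f l r"
  using young_lipschitz[OF assms, of "v - w"] unfolding energy_def
  by (simp add: algebra_simps abs_le_iff abs_if split: if_splits)

text \<open>
  Here \<open>x0\<close>, \<open>x1\<close>, \<open>x2\<close> are three consecutive iterates and \<open>cz\<close>, \<open>cw\<close> are the values of the
  cocoercive operator at \<open>z\<close> and at the zero \<open>w\<close>. Monotonicity is the hypothesis \<open>mono\<close>. The
  cocoercive term is absorbed by Young's inequality, the inertial terms are polarised, and the
  squared distances of \<open>x2\<close> to the extrapolated points are split by the segment identity.
  The coefficient of \<open>q (x2 - 2 x1 + x0)\<close> that results is nonpositive by \<open>cond\<close>.
\<close>

lemma energy_step:
  assumes mono: "0 \<le> (x2 - w) \<bullet> (S (x1 - x2 + t *\<^sub>R (x1 - x0)) + (f1 - f2) - g *\<^sub>R (cz - cw))"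
    and coco: "(z - w) \<bullet> (cz - cw) \<ge> \<mu> * q_dual (cz - cw)"
    and \<mu>: "\<mu> > 0" and g: "g > 0"
    and f1: "0 \<le> l1" "q_dual f1 \<le> l1\<^sup>2 * r"
    and y: "y = x1 + a *\<^sub>R (x1 - x0)" and z: "z = x1 + b *\<^sub>R (x1 - x0)"
    and cond: "0 \<le> t - g * b / (2 * \<mu>) - l2 * a"
  shows "energy w x2 f2 l2 (q (x2 - y)) \<le> energy w x1 f1 l1 r + t * (q (x1 - w) - q (x0 - w))
     - (1 - t - g * (1 - b) / (2 * \<mu>) - l2 * (1 - a) - l1) * q (x2 - x1)
     + (2 * t - g * b * (1 - b) / (2 * \<mu>) - l2 * a * (1 - a)) * q (x1 - x0)"
proof -
  define d e where "d = x1 - x0" and "e = x2 - x1"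
  have x2y: "x2 - y = e - a *\<^sub>R d" and x2z: "x2 - z = e - b *\<^sub>R d"
    by (simp_all add: y z d_def e_def algebra_simps)
  have "2 * ((z - x2) \<bullet> (cz - cw)) \<le> q (z - x2) / (2 * \<mu>) + 2 * \<mu> * q_dual (cz - cw)"
    using young_dual[of "1 / (2 * \<mu>)" "z - x2" "cz - cw"] \<mu> by (simp add: mult.commute)
  moreover have "q (z - x2) = q (x2 - z)"
    unfolding q_def by (simp add: S_linear inner_diff_left inner_diff_right)
  ultimately have "- 2 * ((x2 - w) \<bullet> (cz - cw)) \<le> q (e - b *\<^sub>R d) / (2 * \<mu>)"
    using coco by (simp add: x2z inner_diff_left)
  then have "g * (- 2 * ((x2 - w) \<bullet> (cz - cw))) \<le> g * (q (e - b *\<^sub>R d) / (2 * \<mu>))"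
    using g by (intro mult_left_mono) auto
  then have C: "- 2 * g * ((x2 - w) \<bullet> (cz - cw)) \<le> g / (2 * \<mu>) * q (e - b *\<^sub>R d)" by simp
  have E: "2 * (S e \<bullet> (x2 - w)) = q e + q (x2 - w) - q (x1 - w)"
    using q_polarization[of "x2 - w" e] S_inner_commute[of e "x2 - w"] by (simp add: e_def)
  have D: "2 * (S d \<bullet> (x2 - w)) = q (x1 - w) - q (x0 - w) + 2 * q d + q e - q (e - d)"
  proof -
    have "2 * (S (x1 - w) \<bullet> d) = q (x1 - w) + q d - q (x0 - w)"
      using q_polarization[of "x1 - w" d] by (simp add: d_def)
    moreover have "2 * (S e \<bullet> d) = q e + q d - q (e - d)" by (rule q_polarization)
    moreover have "S d \<bullet> (x2 - w) = S (x1 - w) \<bullet> d + S e \<bullet> d"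
      using S_inner_commute[of d "x2 - w"] by (simp add: e_def S_linear inner_add_left inner_diff_left)
    ultimately show ?thesis by simp
  qed
  have F: "(x2 - w) \<bullet> (f1 - f2) = (x1 - w) \<bullet> f1 + e \<bullet> f1 - (x2 - w) \<bullet> f2"
    by (simp add: e_def inner_diff_right inner_diff_left)
  have "2 * (e \<bullet> f1) \<le> l1 * q e + l1 * r"
    using young_lipschitz[OF f1, of e] by (simp add: distrib_left abs_le_iff)
  moreover have "(x2 - w) \<bullet> (S (x1 - x2 + t *\<^sub>R (x1 - x0)) + (f1 - f2) - g *\<^sub>R (cz - cw))
      = - (S e \<bullet> (x2 - w)) + t * (S d \<bullet> (x2 - w)) + (x2 - w) \<bullet> (f1 - f2)
        - g * ((x2 - w) \<bullet> (cz - cw))"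
  proof -
    have "x1 - x2 + t *\<^sub>R (x1 - x0) = - e + t *\<^sub>R d" by (simp add: d_def e_def)
    then have "S (x1 - x2 + t *\<^sub>R (x1 - x0)) = - S e + t *\<^sub>R S d" by (simp add: S_linear)
    then show ?thesis
      by (simp only: inner_diff_right inner_add_right inner_scaleR_right inner_minus_right
          inner_commute[of "x2 - w" "S _"])
  qed
  ultimately have "energy w x2 f2 l2 (q (x2 - y)) \<le> energy w x1 f1 l1 r - q e + l1 * q e
      + t * (2 * (S d \<bullet> (x2 - w))) + g / (2 * \<mu>) * q (e - b *\<^sub>R d) + l2 * q (e - a *\<^sub>R d)"
    using mono C E F unfolding energy_def x2y by (simp add: algebra_simps)
  also have "\<dots> = energy w x1 f1 l1 r + t * (q (x1 - w) - q (x0 - w))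
     - (1 - t - g * (1 - b) / (2 * \<mu>) - l2 * (1 - a) - l1) * q e
     + (2 * t - g * b * (1 - b) / (2 * \<mu>) - l2 * a * (1 - a)) * q d
     - (t - g * b / (2 * \<mu>) - l2 * a) * q (e - d)"
    unfolding D q_segment using \<mu> by (simp add: field_simps)
  finally show ?thesis
    using mult_nonneg_nonneg[OF cond q_nonneg[of "e - d"]] by (simp add: d_def e_def)
qed

end

section \<open>The inertial descent recursion\<close>

text \<open>
  The Lyapunov function is \<open>\<Phi> n = E n - a n * h n + \<xi> n * D n\<close>. As \<open>a\<close> is non-decreasing, \<open>\<Phi>\<close>
  decreases by at least \<open>\<delta> * D (n + 1)\<close>. This alone does not bound \<open>\<Phi>\<close> below; but
  \<open>E n \<ge> c n * h (n + 1)\<close> and \<open>a n \<le> c n / 2\<close> turn \<open>\<Phi> n \<le> \<Phi> 0\<close> into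
  \<open>h (n + 1) \<le> h n / 2 + const\<close>, so that \<open>h\<close> is bounded, and with it \<open>\<Phi>\<close>.
\<close>

lemma inertial_descent:
  fixes E h D a \<eta> \<xi> c :: "nat \<Rightarrow> real"
  assumes rec: "\<And>n. E (Suc n) \<le> E n + a n * (h (Suc n) - h n) - \<eta> n * D (Suc n) + \<xi> n * D n"
    and h: "\<And>n. 0 \<le> h n" and D: "\<And>n. 0 \<le> D n" and \<xi>: "\<And>n. 0 \<le> \<xi> n"
    and a: "\<And>n. 0 \<le> a n" "\<And>n. a n \<le> a (Suc n)"
    and gap: "\<And>n. \<eta> n - \<xi> (Suc n) \<ge> \<delta>" and \<delta>: "\<delta> > 0"
    and E: "\<And>n. c n * h (Suc n) \<le> E n"
    and c: "\<And>n. \<epsilon> \<le> c n" "\<And>n. c n \<le> 1" "\<And>n. 2 * a n \<le> c n" and \<epsilon>: "\<epsilon> > 0"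
  shows "\<exists>B. \<forall>n. h n \<le> B" "summable D" "convergent (\<lambda>n. E n - a n * h n + \<xi> n * D n)"
proof -
  define \<Phi> where "\<Phi> n = E n - a n * h n + \<xi> n * D n" for n
  have step: "\<Phi> (Suc n) \<le> \<Phi> n - \<delta> * D (Suc n)" for n
  proof -
    have "a n * h (Suc n) \<le> a (Suc n) * h (Suc n)" by (intro mult_right_mono a h)
    moreover have "(\<xi> (Suc n) - \<eta> n) * D (Suc n) \<le> (- \<delta>) * D (Suc n)"
      using gap[of n] by (intro mult_right_mono D) simp
    ultimately show ?thesis using rec[of n] unfolding \<Phi>_def by (simp add: algebra_simps)
  qed
  have dec: "decseq \<Phi>"
    using step \<delta> D by (intro decseq_SucI) (smt (verit) mult_nonneg_nonneg)
  \<comment> \<open>The map \<open>t \<mapsto> t / 2 + P / \<epsilon>\<close> dominates the recursion for \<open>h\<close> and sends \<open>{..B}\<close> into itself.\<close>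
  define P where "P = max (\<Phi> 0) 0"
  define B where "B = max (h 0) (2 * P / \<epsilon>)"
  have P: "0 \<le> P" by (simp add: P_def)
  have B0: "0 \<le> B" using h[of 0] by (simp add: B_def)
  have hB: "h n \<le> B" for n
  proof (induction n)
    case 0
    show ?case by (simp add: B_def)
  next
    case (Suc n)
    have cn: "c n > 0" using c(1)[of n] \<epsilon> by linarith
    have "\<Phi> n \<le> P" using decseqD[OF dec, of 0 n] by (simp add: P_def)
    moreover have "0 \<le> \<xi> n * D n" using \<xi> D by simp
    ultimately have "c n * h (Suc n) \<le> a n * h n + P" using E[of n] unfolding \<Phi>_def by linarith
    also have "a n * h n \<le> c n / 2 * B"
      using c(3)[of n] a(1)[of n] h[of n] Suc.IH by (intro mult_mono) auto
    also have "P \<le> c n / 2 * B"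
    proof -
      have "P \<le> \<epsilon> / 2 * B" using \<epsilon> by (simp add: B_def max_def field_simps)
      also have "\<dots> \<le> c n / 2 * B" using c(1)[of n] B0 by (intro mult_right_mono) auto
      finally show ?thesis .
    qed
    finally have "c n * h (Suc n) \<le> c n * B" by (simp add: mult.commute)
    then show ?case using cn by simp
  qed
  then show "\<exists>B. \<forall>n. h n \<le> B" by blast
  have low: "- B \<le> \<Phi> n" for n
  proof -
    have "0 \<le> c n * h (Suc n)" using c(1)[of n] \<epsilon> h[of "Suc n"] by simp
    moreover have "0 \<le> \<xi> n * D n" using \<xi> D by simp
    moreover have "a n * h n \<le> 1 * B"
      using c(2,3)[of n] a(1)[of n] h[of n] hB[of n] by (intro mult_mono) auto
    ultimately show ?thesis using E[of n] unfolding \<Phi>_def by linarith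
  qed
  obtain L where "\<Phi> \<longlonglongrightarrow> L" using decseq_convergent[OF dec] low by blast
  then show "convergent (\<lambda>n. E n - a n * h n + \<xi> n * D n)"
    unfolding convergent_def \<Phi>_def[abs_def] by blast
  have "(\<Sum>i<n. D (Suc i)) \<le> (\<Phi> 0 - \<Phi> n) / \<delta>" for n
  proof (induction n)
    case (Suc n)
    have "D (Suc n) \<le> (\<Phi> n - \<Phi> (Suc n)) / \<delta>" using step[of n] \<delta> by (simp add: field_simps)
    with Suc.IH show ?case by (simp add: diff_divide_distrib)
  qed simp
  moreover have "(\<Phi> 0 - \<Phi> n) / \<delta> \<le> (\<Phi> 0 + B) / \<delta>" for n
    using low[of n] \<delta> by (intro divide_right_mono) auto
  ultimately have "(\<Sum>i<n. D (Suc i)) \<le> (\<Phi> 0 + B) / \<delta>" for n using order_trans by blast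
  then have "summable (\<lambda>i. D (Suc i))" using D by (intro summableI_nonneg_bounded) auto
  then show "summable D" by (simp add: summable_Suc_iff)
qed

text \<open>
  In the limit the combination is \<open>(1 - a n) * h n\<close>, and \<open>1 - a n\<close> converges to a positive number.
\<close>

lemma convergent_from_inertial_combination:
  fixes h a :: "nat \<Rightarrow> real"
  assumes \<Phi>: "convergent (\<lambda>n. h (Suc n) - a n * h n)"
    and d: "(\<lambda>n. h (Suc n) - h n) \<longlonglongrightarrow> 0"
    and a: "\<And>n. a n \<le> a (Suc n)" "\<And>n. a n \<le> 1 / 2"
  shows "convergent h"
proof -
  obtain L where L: "(\<lambda>n. h (Suc n) - a n * h n) \<longlonglongrightarrow> L" using \<Phi> by (auto simp: convergent_def)
  obtain a0 where a0: "a \<longlonglongrightarrow> a0"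
    using incseq_convergent[of a "1 / 2"] a by (metis incseq_SucI)
  have le: "a0 \<le> 1 / 2" by (rule LIMSEQ_le_const2[OF a0]) (use a(2) in auto)
  have "(\<lambda>n. ((h (Suc n) - a n * h n) - (h (Suc n) - h n)) / (1 - a n)) \<longlonglongrightarrow> (L - 0) / (1 - a0)"
    using le by (intro tendsto_intros L d a0) auto
  moreover have "((h (Suc n) - a n * h n) - (h (Suc n) - h n)) / (1 - a n) = h n" for n
    using a(2)[of n] by (simp add: field_simps)
  ultimately show ?thesis by (auto simp: convergent_def)
qed

theorem theorem4p7:
  fixes S C :: "'a::{real_inner, complete_space} \<Rightarrow> 'a"
    and A :: "'a \<Rightarrow> 'a set"
    and M :: "nat \<Rightarrow> 'a \<Rightarrow> 'a"
    and \<mu> \<gamma>lo \<gamma>hi \<epsilon> \<delta> :: real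
    and \<gamma> \<zeta> \<alpha> \<beta> \<theta> \<alpha>t \<eta> \<xi> :: "nat \<Rightarrow> real"
    and x y z u :: "nat \<Rightarrow> 'a"
    and x_m1 :: 'a
    and N0 :: nat
  assumes S: "bounded_linear S" "self_adjoint S" "strongly_monotone S"
    and A: "maximally_monotone A"
    and C: "\<mu> > 0" "cocoercive_wrt S \<mu> C"
    and Z: "zer (op_sum A (single C)) \<noteq> {}"
    and \<gamma>: "\<gamma>lo > 0" "\<gamma>hi > 0" "\<And>n. \<gamma> n \<in> {\<gamma>lo..\<gamma>hi}"
    and \<epsilon>: "0 < \<epsilon>" "\<epsilon> < 1"
    and \<zeta>: "\<And>n. \<zeta> n \<in> {0..1 - \<epsilon>}"
    and M: "\<And>n. lipschitz_wrt S (\<zeta> n) (\<lambda>v. \<gamma> n *\<^sub>R M n v - S v)"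
    and \<alpha>: "\<And>n. \<alpha> n \<in> {0..1}"
    and \<beta>: "\<And>n. \<beta> n \<in> {0..1}"
    and \<theta>: "\<And>n. \<theta> n \<in> {0..1}"
    and y: "\<And>n. y n = x n + \<alpha> n *\<^sub>R (x n - prev x_m1 x n)"
    and z: "\<And>n. z n = x n + \<beta> n *\<^sub>R (x n - prev x_m1 x n)"
    and x: "\<And>n. x (Suc n) \<in> op_inv (op_sum (single (M n)) A)
              (M n (y n) - C (z n) + (1 / \<gamma> n) *\<^sub>R u n
                + (\<theta> n / \<gamma> n) *\<^sub>R S (x n - prev x_m1 x n))"
    and u: "\<And>n. u (Suc n) =
              (\<gamma> n *\<^sub>R M n (x (Suc n)) - S (x (Suc n))) - (\<gamma> n *\<^sub>R M n (y n) - S (y n))"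
    and \<alpha>t: "\<And>n. n \<ge> 1 \<Longrightarrow> \<alpha>t n = \<alpha> n + \<theta> n"
    and \<eta>: "\<And>n. n \<ge> 1 \<Longrightarrow>
              \<eta> n = 1 - \<alpha>t n - \<gamma> n * (1 - \<beta> n) / (2 * \<mu>) - \<zeta> n * (1 - \<alpha> n) - \<zeta> (n - 1)"
    and \<xi>: "\<And>n. n \<ge> 1 \<Longrightarrow>
              \<xi> n = 2 * \<alpha>t n - \<gamma> n * \<beta> n * (1 - \<beta> n) / (2 * \<mu>) - \<zeta> n * \<alpha> n * (1 - \<alpha> n)"
    and N0: "N0 \<ge> 1" "mono_on {N0..} \<alpha>t"
    and \<delta>: "\<delta> > 0"
    and cond1: "\<And>n. n \<ge> N0 \<Longrightarrow> \<alpha>t n - \<gamma> n * \<beta> n / (2 * \<mu>) - \<zeta> n * \<alpha> n \<ge> 0"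
    and cond2: "\<And>n. n \<ge> N0 \<Longrightarrow> \<eta> n - \<xi> (n + 1) \<ge> \<delta>"
  shows "\<exists>p \<in> zer (op_sum A (single C)). weakly_converges x p"
proof -
  interpret S: bounded_linear S by fact
  interpret hilbert_metric S by unfold_locales (rule S)+
  let ?Z = "zer (op_sum A (single C))"
  define d where "d n = x n - prev x_m1 x n" for n
  have d_Suc: "d (Suc n) = x (Suc n) - x n" for n by (simp add: d_def prev_def)
  have \<gamma>pos: "\<gamma> n > 0" for n using \<gamma>(1) \<gamma>(3)[of n] by simp
  have \<zeta>01: "0 \<le> \<zeta> n" "\<zeta> n \<le> 1 - \<epsilon>" for n using \<zeta>[of n] by auto
  have \<alpha>01: "0 \<le> \<alpha> n" "\<alpha> n \<le> 1" for n using \<alpha>[of n] by auto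
  have \<beta>01: "0 \<le> \<beta> n" "\<beta> n \<le> 1" for n using \<beta>[of n] by auto
  have \<theta>01: "0 \<le> \<theta> n" "\<theta> n \<le> 1" for n using \<theta>[of n] by auto
  have mono: "\<And>s t b c. b \<in> A s \<Longrightarrow> c \<in> A t \<Longrightarrow> (s - t) \<bullet> (b - c) \<ge> 0"
    using A unfolding maximally_monotone_def monotone_op_def by blast
  have coco: "(s - t) \<bullet> (C s - C t) \<ge> \<mu> * q_dual (C s - C t)" for s t
    using C(2) unfolding cocoercive_wrt_def norm_wrt_inv_S_sq by blast
  obtain \<kappa> where \<kappa>: "\<kappa> > 0" "\<And>v. \<kappa> * (norm v)\<^sup>2 \<le> q_dual v" using q_dual_coercive by blast
  define \<nu> where "\<nu> = \<mu> * \<kappa>"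
  have \<nu>: "\<nu> > 0" using \<kappa> C(1) by (simp add: \<nu>_def)
  have coco\<nu>: "(s - t) \<bullet> (C s - C t) \<ge> \<nu> * (norm (C s - C t))\<^sup>2" for s t
  proof -
    have "\<mu> * (\<kappa> * (norm (C s - C t))\<^sup>2) \<le> \<mu> * q_dual (C s - C t)"
      using C(1) \<kappa>(2) by (intro mult_left_mono) auto
    with coco[of s t] show ?thesis by (simp add: \<nu>_def mult.assoc)
  qed
  have C_lip: "norm (C s - C t) \<le> norm (s - t) / \<nu>" for s t
  proof (cases "C s = C t")
    case False
    have "\<nu> * (norm (C s - C t))\<^sup>2 \<le> norm (s - t) * norm (C s - C t)"
      using coco\<nu>[of s t] norm_cauchy_schwarz order_trans by blast
    then have "\<nu> * norm (C s - C t) \<le> norm (s - t)"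
      using False by (simp add: power2_eq_square mult.assoc[symmetric])
    then show ?thesis using \<nu> by (simp add: field_simps)
  qed (use \<nu> in simp)

  have "\<exists>a. a \<in> A (x (Suc n)) \<and> M n (x (Suc n)) + a = M n (y n) - C (z n)
      + (1 / \<gamma> n) *\<^sub>R u n + (\<theta> n / \<gamma> n) *\<^sub>R S (d n)" for n
    using x[of n] unfolding op_inv_def op_sum_def single_def d_def by auto
  then obtain a where aA: "\<And>n. a n \<in> A (x (Suc n))"
    and a_eq: "\<And>n. M n (x (Suc n)) + a n = M n (y n) - C (z n)
      + (1 / \<gamma> n) *\<^sub>R u n + (\<theta> n / \<gamma> n) *\<^sub>R S (d n)"
    by metis
  \<comment> \<open>The residual \<open>\<gamma> n *\<^sub>R (a n + C (z n))\<close> with the kernels eliminated.\<close>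
  define s where "s n = S (x n - x (Suc n) + (\<alpha> n + \<theta> n) *\<^sub>R d n) + (u n - u (Suc n))" for n
  have a_res: "\<gamma> n *\<^sub>R (a n + C (z n)) = s n" for n
  proof -
    have "a n + C (z n) = M n (y n) - M n (x (Suc n)) + (1 / \<gamma> n) *\<^sub>R u n + (\<theta> n / \<gamma> n) *\<^sub>R S (d n)"
      using a_eq[of n] by (simp add: algebra_simps)
    then have "\<gamma> n *\<^sub>R (a n + C (z n)) = \<gamma> n *\<^sub>R M n (y n) - \<gamma> n *\<^sub>R M n (x (Suc n)) + u n
        + \<theta> n *\<^sub>R S (d n)"
      using \<gamma>pos[of n] by (simp add: scaleR_add_right scaleR_diff_right)
    also have "\<dots> = s n"
      unfolding s_def u[of n] y[of n] d_def[symmetric]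
      by (simp add: S.add S.diff S.scaleR scaleR_add_left)
    finally show ?thesis .
  qed

  have u_bound: "q_dual (u (Suc n)) \<le> (\<zeta> n)\<^sup>2 * q (x (Suc n) - y n)" for n
  proof -
    have "norm_wrt (inv S) (u (Suc n)) \<le> \<zeta> n * norm_wrt S (x (Suc n) - y n)"
      using M[of n] unfolding lipschitz_wrt_def u[of n] by blast
    moreover have "0 \<le> norm_wrt (inv S) (u (Suc n))"
      using q_nonneg[of "inv S (u (Suc n))"]
      by (simp add: norm_wrt_def q_dual_def[symmetric] q_dual_eq)
    ultimately have "(norm_wrt (inv S) (u (Suc n)))\<^sup>2 \<le> (\<zeta> n * norm_wrt S (x (Suc n) - y n))\<^sup>2"
      by (rule power_mono)
    then show ?thesis by (simp add: power_mult_distrib norm_wrt_S_sq norm_wrt_inv_S_sq)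
  qed

  \<comment> \<open>The descent starts at \<open>n = N0\<close>, whose predecessor \<open>m\<close> exists; all sequences below are
    indexed by \<open>k\<close> with \<open>n = Suc (m + k)\<close>.\<close>
  obtain m where m: "N0 = Suc m" using N0(1) by (cases N0) auto
  have \<xi>_bounds: "\<alpha>t n \<le> \<xi> n" "\<xi> n \<le> 2 * \<alpha>t n" and \<alpha>t0: "0 \<le> \<alpha>t n" if n: "n \<ge> N0" for n
  proof -
    have n1: "n \<ge> 1" using n N0(1) by simp
    show "0 \<le> \<alpha>t n" using \<alpha>t[OF n1] \<alpha>01 \<theta>01 by simp
    have g: "0 \<le> \<gamma> n * \<beta> n / (2 * \<mu>)" using \<gamma>pos[of n] \<beta>01 C(1) by simp
    have l: "0 \<le> \<zeta> n * \<alpha> n" using \<zeta>01 \<alpha>01 by simp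
    have "\<gamma> n * \<beta> n * (1 - \<beta> n) / (2 * \<mu>) = \<gamma> n * \<beta> n / (2 * \<mu>) * (1 - \<beta> n)" by simp
    moreover have "\<gamma> n * \<beta> n / (2 * \<mu>) * (1 - \<beta> n) \<le> \<gamma> n * \<beta> n / (2 * \<mu>)"
      "0 \<le> \<gamma> n * \<beta> n / (2 * \<mu>) * (1 - \<beta> n)"
      using mult_left_le[OF _ g, of "1 - \<beta> n"] mult_nonneg_nonneg[OF g, of "1 - \<beta> n"] \<beta>01[of n]
      by auto
    moreover have "\<zeta> n * \<alpha> n * (1 - \<alpha> n) \<le> \<zeta> n * \<alpha> n" "0 \<le> \<zeta> n * \<alpha> n * (1 - \<alpha> n)"
      using mult_left_le[OF _ l, of "1 - \<alpha> n"] mult_nonneg_nonneg[OF l, of "1 - \<alpha> n"] \<alpha>01[of n]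
      by auto
    ultimately show "\<alpha>t n \<le> \<xi> n" "\<xi> n \<le> 2 * \<alpha>t n" using cond1[OF n] \<xi>[OF n1] by linarith+
  qed
  have \<alpha>t_mono: "\<alpha>t n \<le> \<alpha>t (Suc n)" if "n \<ge> N0" for n
    using N0(2) that by (auto simp: mono_on_def)
  \<comment> \<open>From \<open>\<eta> n > \<xi> (n + 1) \<ge> \<alpha>t (n + 1) \<ge> \<alpha>t n\<close> and \<open>\<eta> n \<le> 1 - \<alpha>t n - \<zeta> (n - 1)\<close>.\<close>
  have \<alpha>t_half: "2 * \<alpha>t n \<le> 1 - \<zeta> (n - 1)" if n: "n \<ge> N0" for n
  proof -
    have n1: "n \<ge> 1" using n N0(1) by simp
    have "0 \<le> \<gamma> n * (1 - \<beta> n) / (2 * \<mu>)" using \<gamma>pos[of n] \<beta>01 C(1) by simp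
    moreover have "0 \<le> \<zeta> n * (1 - \<alpha> n)" using \<zeta>01 \<alpha>01 by simp
    ultimately show ?thesis
      using \<eta>[OF n1] cond2[OF n] \<delta> \<xi>_bounds(1)[of "Suc n"] \<alpha>t_mono[OF n] n by simp
  qed

  define En where "En w k = energy w (x (Suc (m + k))) (u (Suc (m + k))) (\<zeta> (m + k))
      (q (x (Suc (m + k)) - y (m + k)))" for w k
  define h where "h w k = q (x (m + k) - w)" for w k
  define D where "D k = q (x (Suc (m + k)) - x (m + k))" for k
  have descent: "\<exists>B. \<forall>k. h w k \<le> B" "summable D"
    "convergent (\<lambda>k. En w k - \<alpha>t (Suc (m + k)) * h w k + \<xi> (Suc (m + k)) * D k)"
    if w: "w \<in> ?Z" for w
  proof -
    have Aw: "- C w \<in> A w" using w by (simp add: zer_sum_iff)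
    have rec: "En w (Suc k) \<le> En w k + \<alpha>t (Suc (m + k)) * (h w (Suc k) - h w k)
        - \<eta> (Suc (m + k)) * D (Suc k) + \<xi> (Suc (m + k)) * D k" for k
    proof -
      define n where "n = Suc (m + k)"
      have n: "n \<ge> N0" "n \<ge> 1" by (simp_all add: n_def m)
      have dn: "d n = x n - x (m + k)" by (simp add: n_def d_Suc)
      have "0 \<le> \<gamma> n * ((x (Suc n) - w) \<bullet> (a n - - C w))"
        using mono[OF aA Aw] \<gamma>pos[of n] by simp
      also have "\<gamma> n * ((x (Suc n) - w) \<bullet> (a n - - C w))
          = (x (Suc n) - w) \<bullet> (\<gamma> n *\<^sub>R (a n + C (z n)) - \<gamma> n *\<^sub>R (C (z n) - C w))"
        by (simp add: scaleR_diff_right[symmetric])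
      also have "\<gamma> n *\<^sub>R (a n + C (z n)) - \<gamma> n *\<^sub>R (C (z n) - C w)
          = S (x n - x (Suc n) + \<alpha>t n *\<^sub>R (x n - x (m + k))) + (u n - u (Suc n))
            - \<gamma> n *\<^sub>R (C (z n) - C w)"
        unfolding a_res s_def \<alpha>t[OF n(2)] dn ..
      finally have "0 \<le> (x (Suc n) - w) \<bullet> (S (x n - x (Suc n) + \<alpha>t n *\<^sub>R (x n - x (m + k)))
          + (u n - u (Suc n)) - \<gamma> n *\<^sub>R (C (z n) - C w))" .
      from energy_step[OF this coco C(1) \<gamma>pos[of n] \<zeta>01(1)[of "m + k"] _ _ _ cond1[OF n(1)],
          of "q (x n - y (m + k))" "y n"] u_bound[of "m + k"]
      show ?thesis
        unfolding En_def h_def D_def add_Suc_right n_def[symmetric] \<eta>[OF n(2)] \<xi>[OF n(2)]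
        using y[of n] z[of n] by (simp add: n_def prev_def)
    qed
    have En_lower: "(1 - \<zeta> (m + k)) * h w (Suc k) \<le> En w k" for k
      unfolding En_def h_def add_Suc_right by (rule energy_lower[OF \<zeta>01(1) u_bound])
    note descent = inertial_descent[of "En w" "\<lambda>k. \<alpha>t (Suc (m + k))" "h w" "\<lambda>k. \<eta> (Suc (m + k))" D
        "\<lambda>k. \<xi> (Suc (m + k))" \<delta> "\<lambda>k. 1 - \<zeta> (m + k)" \<epsilon>]
    have a0: "0 \<le> \<alpha>t (Suc (m + k))" "\<alpha>t (Suc (m + k)) \<le> \<alpha>t (Suc (m + Suc k))"
      "0 \<le> \<xi> (Suc (m + k))" "2 * \<alpha>t (Suc (m + k)) \<le> 1 - \<zeta> (m + k)"
      "\<delta> \<le> \<eta> (Suc (m + k)) - \<xi> (Suc (m + Suc k))" for k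
      using \<alpha>t0[of "Suc (m + k)"] \<alpha>t_mono[of "Suc (m + k)"] \<xi>_bounds(1)[of "Suc (m + k)"]
        \<alpha>t_half[of "Suc (m + k)"] cond2[of "Suc (m + k)"] by (simp_all add: m)
    have c0: "\<epsilon> \<le> 1 - \<zeta> (m + k)" "1 - \<zeta> (m + k) \<le> 1" for k using \<zeta>01[of "m + k"] by auto
    have hD: "0 \<le> h w k" "0 \<le> D k" for k by (simp_all add: h_def D_def)
    note facts = rec hD a0(3) a0(1,2) a0(5) \<delta> En_lower c0 a0(4) \<epsilon>(1)
    show "\<exists>B. \<forall>k. h w k \<le> B" "summable D"
      "convergent (\<lambda>k. En w k - \<alpha>t (Suc (m + k)) * h w k + \<xi> (Suc (m + k)) * D k)"
      by (rule descent; rule facts)+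
  qed

  obtain w0 where w0: "w0 \<in> ?Z" using Z by blast
  have D0: "D \<longlonglongrightarrow> 0" using descent(2)[OF w0] by (rule summable_LIMSEQ_zero)
  have "(\<lambda>k. x (Suc (m + k)) - x (m + k)) \<longlonglongrightarrow> 0"
    by (rule q_tendsto_0_imp) (use D0 in \<open>simp add: D_def[abs_def]\<close>)
  then have step0: "(\<lambda>n. x (Suc n) - x n) \<longlonglongrightarrow> 0"
    using LIMSEQ_offset[of "\<lambda>n. x (Suc n) - x n" m 0] by (simp add: add.commute)
  then have d0: "d \<longlonglongrightarrow> 0" by (intro LIMSEQ_imp_Suc[of d]) (simp add: d_Suc)
  \<comment> \<open>To be used with \<open>\<alpha>\<close>, \<open>\<beta>\<close> and \<open>\<theta>\<close>.\<close>
  have extrapolated0: "(\<lambda>n. x (Suc n) - (x n + c n *\<^sub>R d n)) \<longlonglongrightarrow> 0"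
    if c: "\<And>n. 0 \<le> c n \<and> c n \<le> 1" for c :: "nat \<Rightarrow> real"
  proof -
    have "(\<lambda>n. c n *\<^sub>R d n) \<longlonglongrightarrow> 0"
    proof (rule Lim_null_comparison[OF always_eventually tendsto_norm_zero[OF d0]], rule allI)
      fix n show "norm (c n *\<^sub>R d n) \<le> norm (d n)"
        using c[of n] by (simp add: mult_left_le_one_le)
    qed
    from tendsto_diff[OF step0 this] show ?thesis by (simp add: algebra_simps)
  qed
  obtain R where R: "\<And>n. norm (x n) \<le> R"
  proof -
    obtain B where B: "\<And>k. h w0 k \<le> B" using descent(1)[OF w0] by blast
    obtain K where K: "K > 0" "\<And>v. K * (norm v)\<^sup>2 \<le> q v" using q_coercive by blast
    have "norm (x (k + m)) \<le> sqrt (B / K) + norm w0" for k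
    proof -
      have "K * (norm (x (m + k) - w0))\<^sup>2 \<le> B" using K(2) B[of k] unfolding h_def by (rule order_trans)
      then have "norm (x (m + k) - w0) \<le> sqrt (B / K)"
        using K(1) by (intro real_le_rsqrt) (simp add: pos_le_divide_eq mult.commute)
      moreover have "norm (x (m + k)) \<le> norm (x (m + k) - w0) + norm w0"
        using norm_triangle_ineq[of "x (m + k) - w0" w0] by simp
      ultimately show ?thesis by (simp add: add.commute)
    qed
    then have "Bseq (\<lambda>k. x (k + m))" by (rule BseqI')
    then have "Bseq x" by (rule Bseq_offset)
    then show thesis using that unfolding Bseq_def by blast
  qed
  have qy0: "(\<lambda>n. q (x (Suc n) - y n)) \<longlonglongrightarrow> 0"
    using q_tendsto[OF extrapolated0[of \<alpha>]] \<alpha>01 y by (simp add: d_def)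
  have u0: "u \<longlonglongrightarrow> 0"
  proof (rule LIMSEQ_imp_Suc, rule q_dual_tendsto_0_imp,
      rule Lim_null_comparison[OF always_eventually qy0], rule allI)
    fix n
    have "(\<zeta> n)\<^sup>2 * q (x (Suc n) - y n) \<le> 1 * q (x (Suc n) - y n)"
      using \<zeta>01[of n] \<epsilon> by (intro mult_right_mono power_le_one) auto
    with u_bound[of n] show "norm (q_dual (u (Suc n))) \<le> q (x (Suc n) - y n)"
      by (simp add: q_dual_eq)
  qed

  have conv: "convergent (\<lambda>n. q (x n - w))" if w: "w \<in> ?Z" for w
  proof -
    have "(\<lambda>n. 2 * (norm (u n) * (R + norm w))) \<longlonglongrightarrow> 2 * (norm (0::'a) * (R + norm w))"
      by (intro tendsto_intros u0)
    then have uR: "(\<lambda>n. 2 * (norm (u n) * (R + norm w))) \<longlonglongrightarrow> 0" by simp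
    have xw: "norm (x n - w) \<le> R + norm w" for n
      using norm_triangle_ineq4[of "x n" w] R[of n] by linarith
    have cross: "(\<lambda>n. 2 * ((x n - w) \<bullet> u n)) \<longlonglongrightarrow> 0"
    proof (rule Lim_null_comparison[OF always_eventually uR], rule allI)
      fix n
      have "\<bar>(x n - w) \<bullet> u n\<bar> \<le> norm (x n - w) * norm (u n)" by (rule Cauchy_Schwarz_ineq2)
      also have "\<dots> \<le> (R + norm w) * norm (u n)" by (intro mult_right_mono xw) simp
      finally show "norm (2 * ((x n - w) \<bullet> u n)) \<le> 2 * (norm (u n) * (R + norm w))"
        by (simp add: mult.commute)
    qed
    have \<zeta>q: "(\<lambda>n. \<zeta> n * q (x (Suc n) - y n)) \<longlonglongrightarrow> 0"
    proof (rule Lim_null_comparison[OF always_eventually qy0], rule allI)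
      fix n show "norm (\<zeta> n * q (x (Suc n) - y n)) \<le> q (x (Suc n) - y n)"
        using \<zeta>01[of n] \<epsilon> by (simp add: mult_left_le_one_le)
    qed
    have \<xi>D: "(\<lambda>k. \<xi> (Suc (m + k)) * D k) \<longlonglongrightarrow> 0"
    proof (rule Lim_null_comparison[OF always_eventually D0], rule allI)
      fix k
      have "0 \<le> \<xi> (Suc (m + k))" "\<xi> (Suc (m + k)) \<le> 1"
        using \<xi>_bounds[of "Suc (m + k)"] \<alpha>t0[of "Suc (m + k)"] \<alpha>t_half[of "Suc (m + k)"] \<zeta>01(1)[of "m + k"]
        by (simp_all add: m)
      then show "norm (\<xi> (Suc (m + k)) * D k) \<le> D k"
        by (simp add: D_def mult_left_le_one_le)
    qed
    obtain L where "(\<lambda>k. En w k - \<alpha>t (Suc (m + k)) * h w k + \<xi> (Suc (m + k)) * D k) \<longlonglongrightarrow> L"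
      using descent(3)[OF w] by (auto simp: convergent_def)
    moreover have "(\<lambda>k. 2 * ((x (Suc (m + k)) - w) \<bullet> u (Suc (m + k)))) \<longlonglongrightarrow> 0"
      using LIMSEQ_ignore_initial_segment[OF cross, of "Suc m"] by (simp add: add.commute)
    moreover have "(\<lambda>k. \<zeta> (m + k) * q (x (Suc (m + k)) - y (m + k))) \<longlonglongrightarrow> 0"
      using LIMSEQ_ignore_initial_segment[OF \<zeta>q, of m] by (simp add: add.commute)
    ultimately have "(\<lambda>k. (En w k - \<alpha>t (Suc (m + k)) * h w k + \<xi> (Suc (m + k)) * D k)
        - 2 * ((x (Suc (m + k)) - w) \<bullet> u (Suc (m + k)))
        - \<zeta> (m + k) * q (x (Suc (m + k)) - y (m + k)) - \<xi> (Suc (m + k)) * D k) \<longlonglongrightarrow> L - 0 - 0 - 0"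
      by (intro tendsto_diff \<xi>D)
    then have "convergent (\<lambda>k. h w (Suc k) - \<alpha>t (Suc (m + k)) * h w k)"
      unfolding convergent_def En_def energy_def h_def by (auto intro!: exI[of _ L])
    moreover have "(\<lambda>k. h w (Suc k) - h w k) \<longlonglongrightarrow> 0"
    proof -
      have "(\<lambda>n. q (x (Suc n) - w) - q (x n - w)) \<longlonglongrightarrow> 0"
        using step0 xw by (intro q_diff_tendsto_0[where B = "R + norm w"]) auto
      from LIMSEQ_ignore_initial_segment[OF this, of m] show ?thesis
        by (simp add: h_def add.commute)
    qed
    moreover have "\<alpha>t (Suc (m + k)) \<le> \<alpha>t (Suc (m + Suc k))" "\<alpha>t (Suc (m + k)) \<le> 1 / 2" for k
      using \<alpha>t_mono[of "Suc (m + k)"] \<alpha>t_half[of "Suc (m + k)"] \<zeta>01(1)[of "m + k"] by (simp_all add: m)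
    ultimately have "convergent (h w)" by (rule convergent_from_inertial_combination)
    then show ?thesis
      using convergent_ignore_initial_segment[of "\<lambda>n. q (x n - w)" m]
      by (simp add: h_def[abs_def] add.commute)
  qed

  have s_lim: "s \<longlonglongrightarrow> 0"
  proof -
    have "(\<lambda>n. - (x (Suc n) - (x n + \<alpha> n *\<^sub>R d n)) - (x (Suc n) - (x n + \<theta> n *\<^sub>R d n)) + (x (Suc n) - x n))
        \<longlonglongrightarrow> - 0 - 0 + 0"
      using \<alpha>01 \<theta>01 by (intro tendsto_intros step0 extrapolated0) auto
    then have "(\<lambda>n. x n - x (Suc n) + (\<alpha> n + \<theta> n) *\<^sub>R d n) \<longlonglongrightarrow> 0"
      by (simp add: algebra_simps)
    then have "(\<lambda>n. S (x n - x (Suc n) + (\<alpha> n + \<theta> n) *\<^sub>R d n) + (u n - u (Suc n))) \<longlonglongrightarrow> S 0 + (0 - 0)"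
      by (intro tendsto_add tendsto_diff S.tendsto u0 LIMSEQ_Suc[OF u0])
    then show ?thesis by (simp add: s_def[abs_def] S.zero)
  qed
  have "(\<lambda>n. a n + C (x (Suc n))) \<longlonglongrightarrow> 0"
  proof -
    have "(\<lambda>n. x (Suc n) - z n) \<longlonglongrightarrow> 0"
      using extrapolated0[of \<beta>] \<beta>01 by (simp add: z d_def)
    then have z0: "(\<lambda>n. norm (x (Suc n) - z n) / \<nu>) \<longlonglongrightarrow> 0"
      by (intro tendsto_divide_zero tendsto_norm_zero)
    have Cz: "(\<lambda>n. C (x (Suc n)) - C (z n)) \<longlonglongrightarrow> 0"
      by (rule Lim_null_comparison[OF always_eventually z0]) (simp add: C_lip)
    have s0: "(\<lambda>n. norm (s n) / \<gamma>lo) \<longlonglongrightarrow> 0"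
      by (intro tendsto_divide_zero tendsto_norm_zero s_lim)
    have aCz: "(\<lambda>n. a n + C (z n)) \<longlonglongrightarrow> 0"
    proof (rule Lim_null_comparison[OF always_eventually s0], rule allI)
      fix n
      have "\<gamma>lo * norm (a n + C (z n)) \<le> \<gamma> n * norm (a n + C (z n))"
        using \<gamma>(3)[of n] by (intro mult_right_mono) auto
      also have "\<dots> = norm (s n)" using \<gamma>pos[of n] by (simp flip: a_res)
      finally show "norm (a n + C (z n)) \<le> norm (s n) / \<gamma>lo"
        using \<gamma>(1) by (simp add: pos_le_divide_eq mult.commute)
    qed
    from tendsto_add[OF aCz Cz] show ?thesis by (simp add: add_diff_eq)
  qed
  then have residual0: "(\<lambda>n. a (n - 1) + C (x n)) \<longlonglongrightarrow> 0"
    by (intro LIMSEQ_imp_Suc[of "\<lambda>n. a (n - 1) + C (x n)"]) simp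

  show ?thesis
  proof (rule opial[OF R conv])
    fix G p assume G: "G \<le> sequentially" "G \<noteq> bot" "weakly_tendsto x p G"
    have "eventually (\<lambda>n. a (n - 1) \<in> A (x n)) sequentially"
      using eventually_ge_at_top[of 1]
    proof eventually_elim
      case (elim n)
      then show ?case using aA[of "n - 1"] by simp
    qed
    then have "eventually (\<lambda>n. a (n - 1) \<in> A (x n)) G" by (rule filter_leD[OF G(1)])
    moreover have "((\<lambda>n. a (n - 1) + C (x n)) \<longlongrightarrow> 0) G" by (rule tendsto_mono[OF G(1) residual0])
    ultimately show "p \<in> ?Z"
      using weak_cluster_point_in_zer[OF A \<nu> coco\<nu> w0 G(2), of x R "\<lambda>n. a (n - 1)" p] R G(3) by blast
  qed
qed

end
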